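(* Let $\mathcal H$ be a real Hilbert space and let $U_i\colon\mathcal{H}\to\mathcal{H}$ be a cutter for each $i\in I:=\{1,\ldots,M\}$, such that $C:=\bigcap_{i\in I} \operatorname{Fix} U_i \neq \emptyset$. Let $\{J_1,\ldots,J_N\}$ be a family of strings satisfying $I=J_1\cup\ldots\cup J_N$. Let $T$ be the string averaging cutter operator defined by $$T:=\sum_{n=1}^{N} \omega_n Q_n,$$ where $\omega_n\in(0,1]$ with $\sum_{n=1}^{N}\omega_n=1$ and $Q_n:=\prod_{j\in J_n} U_j$. Let $m_n:=|J_n|$, $m:=\max_{1\leq n\leq N} m_n$ and, for each string $J_n=(i_{1},\ldots,i_{m_n})$, let $Q_{n,l}:=\prod_{j=1}^{l} U_{i_j}$ and $Q_{n,0}:=\operatorname{Id}$. Let $T_{\lambda\sigma}\colon\mathcal H \to \mathcal H$ be defined by $$T_{\lambda\sigma} x:= x + \lambda\sigma(x)(Tx-x),$$ where the relaxation parameter $\lambda\in (0,1+ \frac 1 m)$, and the extrapolation functional $\sigma\colon\mathcal H \to [1,\infty)$ satisfies $1\leq \sigma(x) \leq \tau(x)$ for all $x\in\mathcal H$, where $$\tau(x):=\frac{\frac{m}{m+1}\sum_{n=1}^{N} \omega_n\left(\left\|Q_nx-x \right\|^2+\sum_{l=1}^{m_n}\|Q_{n,l}x-Q_{n,l-1}x\|^2\right)}{\left\|T x-x\right\|^{2}}\quad\text{if } x\notin C,$$ and $\tau(x):=1$ otherwise. Then the following statements hold: (i) $T_{\lambda\sigma}$ is $\rho$-SQNE, where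 $\operatorname{Fix} T_{\lambda\sigma}=C$ and $\rho:=\frac 1 {\lambda m} + \frac{1-\lambda}{\lambda}>0$. Moreover, for all $x\in \mathcal H$ and $z\in C$, we have $$\Theta(x)\sum_{n=1}^{N}\omega_n \sum_{l=1}^{m_n}\big\|Q_{n,l}x-Q_{n,l-1}x\big\|^2\leq \|x-z\|^2 - \|T_{\lambda\sigma} x- z\|^2,$$ where $$\Theta(x):=\lambda\sigma (x)\frac{1+m-m\lambda\frac{\sigma(x)}{\tau(x)}}{1+m-\frac{m}{\tau(x)}}\geq \lambda \left(1-\lambda \frac {m} {1+m}\right)>0.$$ (ii) If for every $i\in I$ the operator $U_i$ is $\delta_i$-linearly regular, $\delta_i\in(0,1]$, on the ball $B(z,r)$ for some $z\in C$ and some $r>0$, then for all $x\in B(z,r)$ we have $$\delta^2 \max_{i\in I} d^2(x,\operatorname{Fix} U_i) \leq \sum_{n=1}^{N} \sum_{l=1}^{m_n} m_n \big\|Q_{n,l}x-Q_{n,l-1}x\big\|^2,$$ where $\delta:=\min_{i\in I} \delta_i$. (iii) If, in addition to the assumptions of (ii), the family $\{\operatorname{Fix} U_i\mid i\in I\}$ is $\kappa$-linearly regular over $B(z,r)$, then $T_{\lambda\sigma}$ also satisfies $$\Theta(x) \frac{\omega\delta^2}{2m\kappa^2} d(x,C)\leq \|T_{\lambda\sigma} x-x\|$$ for all $x\in B(z,r)$, where $\omega:=\min_{n=1,\ldots, N}\omega_n$. Moreover, in this case $$\Theta(x)\leq \frac{m\kappa^2}{\omega\delta^2 }.$$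
   Context: $\mathcal H$ is a real Hilbert space; $\operatorname{Id}$ is the identity; $\operatorname{Fix} U$ is the fixed point set of $U$; $d(x,C)=\inf_{z\in C}\|x-z\|$; $B(z,r)$ is the closed ball with center $z$ and radius $r$. An operator $U\colon\mathcal H\to\mathcal H$ with $\operatorname{Fix}U\ne\emptyset$ is a cutter if $\langle z-Ux,x-Ux\rangle\le 0$ for all $x\in\mathcal H$ and $z\in\operatorname{Fix}U$. For $\rho\ge0$, $U$ is $\rho$-strongly quasi-nonexpansive ($\rho$-SQNE) if $\|Ux-z\|^2\le\|x-z\|^2-\rho\|Ux-x\|^2$ for all $x\in\mathcal H$ and $z\in\operatorname{Fix}U$. A string is a nonempty ordered subset $J=(i_1,\ldots,i_p)$ of $I$; the product along it is $\prod_{j\in J}U_j:=U_{i_p}\cdots U_{i_1}$ (so $U_{i_1}$ is applied first); similarly $\prod_{j=1}^lU_{i_j}:=U_{i_l}\cdots U_{i_1}$. Let $S\subseteq\mathcal H$ be nonempty. An operator $U$ with a fixed point is $\delta_S$-linearly regular over (on) $S$, where $\delta_S>0$, if $\delta_S\, d(x,\operatorname{Fix}U)\le\|Ux-x\|$ for all $x\in S$. A family $\{C_1,\ldots,C_M\}$ of closed convex sets with nonempty intersection $C$ is $\kappa$-linearly regular over $S$, where $\kappa>0$, if $d(x,C)\le\kappa\max_i d(x,C_i)$ for all $x\in S$.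
   Formalization: The last bound of (iii), on Θ(x), is proved for x in B(z,r) and, when B(z,r) is contained in C, only for κ ≥ 1; without this it fails, e.g. for U_1 = Id, M = N = 1, λ = δ_1 = 1, κ = 1/10. *)

theory Defs
  imports "HOL-Analysis.Analysis"
begin

definition Fix :: "('a \<Rightarrow> 'a) \<Rightarrow> 'a set" where
  "Fix U = {x. U x = x}"

definition cutter :: "('a::real_inner \<Rightarrow> 'a) \<Rightarrow> bool" where
  "cutter U \<longleftrightarrow>
     Fix U \<noteq> {} \<and> (\<forall>x. \<forall>z\<in>Fix U. inner (z - U x) (x - U x) \<le> 0)"

definition SQNE :: "real \<Rightarrow> ('a::real_inner \<Rightarrow> 'a) \<Rightarrow> bool" where
  "SQNE \<rho> U \<longleftrightarrow> 0 \<le> \<rho> \<and>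
     (\<forall>x. \<forall>z\<in>Fix U. (norm (U x - z))\<^sup>2 \<le> (norm (x - z))\<^sup>2 - \<rho> * (norm (U x - x))\<^sup>2)"

text \<open>
  An ordered subset of \<open>I\<close> is a list without repetitions, so its cardinality is its length.
\<close>

definition index_string :: "'i set \<Rightarrow> 'i list \<Rightarrow> bool" where
  "index_string I js \<longleftrightarrow> js \<noteq> [] \<and> distinct js \<and> set js \<subseteq> I"

text \<open>
  With \<open>fold\<close> the head of the list acts first:
  \<open>string_prod U [i, j, k] x = U k (U j (U i x))\<close>, and \<open>string_prod U [] = id\<close>.
\<close>

definition string_prod :: "('i \<Rightarrow> 'a \<Rightarrow> 'a) \<Rightarrow> 'i list \<Rightarrow> 'a \<Rightarrow> 'a" where
  "string_prod U js = fold U js"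

text \<open>
  Both regularity notions presuppose that the distances are taken to nonempty sets;
  this is recorded explicitly because \<open>infdist x {} = 0\<close>.
\<close>

definition linearly_regular_op ::
    "real \<Rightarrow> 'a::real_inner set \<Rightarrow> ('a \<Rightarrow> 'a) \<Rightarrow> bool" where
  "linearly_regular_op \<delta> S U \<longleftrightarrow>
     0 < \<delta> \<and> Fix U \<noteq> {} \<and> (\<forall>x\<in>S. \<delta> * infdist x (Fix U) \<le> norm (U x - x))"

text \<open>
  The index set is meant to be finite and nonempty. The usual standing assumption that the
  sets are closed and convex is not built in; fixed point sets of cutters always are.
\<close>

definition linearly_regular_family ::
    "real \<Rightarrow> 'a::real_inner set \<Rightarrow> 'i set \<Rightarrow> ('i \<Rightarrow> 'a set) \<Rightarrow> bool" where
  "linearly_regular_family \<kappa> S I D \<longleftrightarrow>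
     0 < \<kappa> \<and> (\<Inter>i\<in>I. D i) \<noteq> {} \<and>
     (\<forall>x\<in>S. infdist x (\<Inter>i\<in>I. D i) \<le> \<kappa> * (MAX i\<in>I. infdist x (D i)))"

end

theory Submission
  imports Defs
begin

text \<open>
  Everything rests on one inequality. A cutter pays for each move: \<open>\<parallel>U x - z\<parallel>\<^sup>2 + \<parallel>U x - x\<parallel>\<^sup>2 \<le> \<parallel>x - z\<parallel>\<^sup>2\<close>
  for every fixed point \<open>z\<close> (\<open>cutter_fejer\<close>). Along a string these payments telescope, so the end
  point \<open>q\<close> satisfies \<open>\<parallel>q - z\<parallel>\<^sup>2 + s \<le> \<parallel>x - z\<parallel>\<^sup>2\<close>, where \<open>s\<close> is the sum of the squared step lengths
  and \<open>z\<close> is a common fixed point. Expanding the square turns this into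
  \<open>\<parallel>q - x\<parallel>\<^sup>2 + s \<le> 2 \<langle>z - x, q - x\<rangle>\<close>, an inequality that is linear in \<open>q\<close> on the right and can
  therefore be averaged over the strings: with \<open>D\<close> the weighted mean of \<open>\<parallel>q - x\<parallel>\<^sup>2\<close>
  and \<open>E\<close> the weighted mean of \<open>s\<close>, the averaged operator \<open>T\<close> satisfies
  \<open>D + E \<le> 2 \<langle>z - x, T x - x\<rangle>\<close> (\<open>average_inner_ge\<close>).

  A step of length \<open>a\<close> in the direction \<open>T x - x\<close> thus decreases the squared distance to \<open>z\<close> by at
  least \<open>a (D + E) - a\<^sup>2 d\<close>, where \<open>d = \<parallel>T x - x\<parallel>\<^sup>2\<close> (\<open>relaxed_step\<close>). The extrapolation bound \<open>\<tau>\<close> is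
  chosen so that \<open>\<tau> d (m + 1) = m (D + E)\<close>; on the common fixed points both sides vanish, so this
  identity holds everywhere. Together with Jensen's inequality \<open>d \<le> D\<close> it reduces the strong
  quasi-nonexpansiveness and the descent estimate with factor \<open>\<Theta>\<close> to inequalities between real
  numbers.

  For regularity, an operator \<open>U\<^sub>i\<close> occurring in a string acts on a point that is at most the sum of
  the earlier step lengths away from \<open>x\<close>, and still lies in the given ball. Linear regularity bounds
  the distance from that point to \<open>Fix U\<^sub>i\<close> by \<open>1 / \<delta>\<close> times the next step length, and the Cauchy--Schwarz
  inequality passes from the sum of the steps to the sum of their squares
  (\<open>string_energy_regularity\<close>). Regularity of the family then gives \<open>b d(x,C)\<^sup>2 \<le> E\<close> for an explicit
  \<open>b\<close>. Inserting this into the descent estimate and letting \<open>z\<close> approach the infimum in \<open>d(x,C)\<close>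
  yields the linear lower bound on the displacement, and \<open>\<Theta> b \<le> 1\<close> outside \<open>C\<close>. On \<open>C\<close>
  the factor is \<open>\<lambda> (1 + m - m \<lambda>)\<close>, which never exceeds \<open>m\<close>, while \<open>b \<le> 1 / m\<close> once the regularity
  constant of the family is at least \<open>1\<close>.
\<close>

section \<open>Cutters\<close>

lemma cutter_fejer:
  assumes "cutter U" "z \<in> Fix U"
  shows "(norm (U x - z))\<^sup>2 + (norm (U x - x))\<^sup>2 \<le> (norm (x - z))\<^sup>2"
proof -
  have "inner (z - U x) (x - U x) \<le> 0"
    using assms by (simp add: cutter_def)
  then show ?thesis
    by (simp add: power2_norm_eq_inner inner_simps inner_commute)
qed

text \<open>
  Each \<open>x\<close> contributes one closed half-space containing all fixed points; a point \<open>z\<close> in all of them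
  is fixed, because the half-space of \<open>x = z\<close> forces \<open>\<parallel>z - U z\<parallel>\<^sup>2 \<le> 0\<close>. Closedness of
  the fixed point set is read off from this description.
\<close>
lemma Fix_cutter_eq_halfspaces:
  assumes "cutter U"
  shows "Fix U = (\<Inter>x. {z. inner (x - U x) z \<le> inner (x - U x) (U x)})"
proof (rule set_eqI, rule iffI)
  fix z assume "z \<in> Fix U"
  then have "inner (z - U x) (x - U x) \<le> 0" for x
    using assms by (simp add: cutter_def)
  then show "z \<in> (\<Inter>x. {z. inner (x - U x) z \<le> inner (x - U x) (U x)})"
    by (simp add: inner_simps inner_commute)
next
  fix z assume "z \<in> (\<Inter>x. {z. inner (x - U x) z \<le> inner (x - U x) (U x)})"
  then have "inner (z - U z) (z - U z) \<le> 0"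
    by (simp add: inner_diff_right)
  then have "z - U z = 0"
    using inner_gt_zero_iff[of "z - U z"] by linarith
  then show "z \<in> Fix U"
    by (simp add: Fix_def)
qed

lemma closed_Fix_cutter: "cutter U \<Longrightarrow> closed (Fix U)"
  by (subst Fix_cutter_eq_halfspaces) (auto intro: closed_INT closed_halfspace_le)

section \<open>Strings of cutters\<close>

definition string_energy :: "('i \<Rightarrow> 'a::real_inner \<Rightarrow> 'a) \<Rightarrow> 'i list \<Rightarrow> 'a \<Rightarrow> real" where
  "string_energy U js x =
     (\<Sum>l<length js. (norm (string_prod U (take (Suc l) js) x - string_prod U (take l js) x))\<^sup>2)"

lemma string_prod_Nil [simp]: "string_prod U [] x = x"
  by (simp add: string_prod_def)

lemma string_prod_take_Suc:
  "l < length js \<Longrightarrow>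
     string_prod U (take (Suc l) js) x = U (js ! l) (string_prod U (take l js) x)"
  by (simp add: string_prod_def take_Suc_conv_app_nth)

lemma string_energy_nonneg: "0 \<le> string_energy U js x"
  by (simp add: string_energy_def sum_nonneg)

text \<open>
  The squared distances to \<open>z\<close> telescope along the string, since \<open>z\<close> is fixed by every operator
  in it. The induction runs over prefixes because the regularity argument below also needs the
  bound at intermediate points.
\<close>
lemma string_prod_take_fejer:
  assumes "\<And>i. i \<in> set js \<Longrightarrow> cutter (U i) \<and> z \<in> Fix (U i)" and "l \<le> length js"
  shows "(norm (string_prod U (take l js) x - z))\<^sup>2
           + (\<Sum>k<l. (norm (string_prod U (take (Suc k) js) x - string_prod U (take k js) x))\<^sup>2)
         \<le> (norm (x - z))\<^sup>2"
  using assms(2)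
proof (induction l)
  case (Suc l)
  then have "l < length js" by simp
  then have "cutter (U (js ! l)) \<and> z \<in> Fix (U (js ! l))"
    using assms(1) nth_mem by blast
  from cutter_fejer[OF conjunct1[OF this] conjunct2[OF this], of "string_prod U (take l js) x"]
  show ?case
    using Suc.IH \<open>l < length js\<close> by (simp add: string_prod_take_Suc)
qed simp

lemma string_prod_take_dist_le:
  assumes "\<And>i. i \<in> set js \<Longrightarrow> cutter (U i) \<and> z \<in> Fix (U i)" and "l \<le> length js"
  shows "norm (string_prod U (take l js) x - z) \<le> norm (x - z)"
proof (rule power2_le_imp_le)
  have "0 \<le> (\<Sum>k<l. (norm (string_prod U (take (Suc k) js) x - string_prod U (take k js) x))\<^sup>2)"
    by (simp add: sum_nonneg)
  with string_prod_take_fejer[of js U z l x, OF assms]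
  show "(norm (string_prod U (take l js) x - z))\<^sup>2 \<le> (norm (x - z))\<^sup>2"
    by linarith
qed simp

text \<open>
  Expanding \<open>\<parallel>Q x - z\<parallel>\<^sup>2\<close> around \<open>x\<close> cancels \<open>\<parallel>x - z\<parallel>\<^sup>2\<close> from the telescoped inequality. In this form
  the right-hand side is linear in the displacement, so that it survives convex combinations.
\<close>
lemma string_prod_inner_ge:
  assumes "\<And>i. i \<in> set js \<Longrightarrow> cutter (U i) \<and> z \<in> Fix (U i)"
  shows "(norm (string_prod U js x - x))\<^sup>2 + string_energy U js x
           \<le> 2 * inner (z - x) (string_prod U js x - x)"
proof -
  have "(norm (string_prod U js x - z))\<^sup>2 + string_energy U js x \<le> (norm (x - z))\<^sup>2"
    using string_prod_take_fejer[of js U z "length js" x] assms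
    by (simp add: string_energy_def)
  then show ?thesis
    by (simp add: power2_norm_eq_inner inner_simps inner_commute)
qed

lemma string_prod_fixed:
  assumes "\<And>i. i \<in> set js \<Longrightarrow> U i x = x"
  shows "string_prod U js x = x"
  using assms by (induction js) (simp_all add: string_prod_def)

lemma string_energy_eq_0_imp_fixed:
  assumes "string_energy U js x = 0" and "i \<in> set js"
  shows "U i x = x"
proof -
  have step: "string_prod U (take (Suc l) js) x = string_prod U (take l js) x"
    if "l < length js" for l
    using assms(1) that by (simp add: string_energy_def sum_nonneg_eq_0_iff)
  have stay: "string_prod U (take l js) x = x" if "l \<le> length js" for l
    using that by (induction l) (simp_all add: step)
  obtain p where p: "p < length js" "js ! p = i"
    using assms(2) by (auto simp: in_set_conv_nth)
  have "U (js ! p) (string_prod U (take p js) x) = string_prod U (take p js) x"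
    using step[OF p(1)] string_prod_take_Suc[OF p(1)] by metis
  then show ?thesis
    using p stay[of p] by simp
qed

lemma string_prod_take_displacement:
  fixes U :: "'i \<Rightarrow> 'a::real_inner \<Rightarrow> 'a"
  shows "norm (string_prod U (take l js) x - x)
           \<le> (\<Sum>k<l. norm (string_prod U (take (Suc k) js) x - string_prod U (take k js) x))"
proof -
  have "string_prod U (take l js) x - x
        = (\<Sum>k<l. string_prod U (take (Suc k) js) x - string_prod U (take k js) x)"
    using sum_lessThan_telescope[of "\<lambda>k. string_prod U (take k js) x" l] by simp
  then show ?thesis
    by (metis norm_sum)
qed

text \<open>
  If \<open>U\<^sub>i\<close> is the operator applied after \<open>p\<close> steps, to a point \<open>y\<close>, then \<open>d(x, Fix U\<^sub>i)\<close> is at most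
  \<open>\<parallel>x - y\<parallel>\<close>, bounded by the first \<open>p\<close> step lengths, plus \<open>d(y, Fix U\<^sub>i)\<close>, which regularity bounds by the next step
  length divided by \<open>\<delta>\<close>. Regularity may be used at \<open>y\<close> since the string does not move points away
  from the centre \<open>z\<close> of the ball. The number of steps enters through Cauchy--Schwarz.
\<close>
lemma string_energy_regularity:
  fixes U :: "'i \<Rightarrow> 'a::real_inner \<Rightarrow> 'a"
  assumes cut: "\<And>i. i \<in> set js \<Longrightarrow> cutter (U i) \<and> z \<in> Fix (U i)"
    and \<delta>: "0 < \<delta>" "\<delta> \<le> 1"
    and reg: "\<And>i y. i \<in> set js \<Longrightarrow> y \<in> cball z r \<Longrightarrow> \<delta> * infdist y (Fix (U i)) \<le> norm (U i y - y)"
    and x: "x \<in> cball z r" and i: "i \<in> set js"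
  shows "\<delta>\<^sup>2 * (infdist x (Fix (U i)))\<^sup>2 \<le> length js * string_energy U js x"
proof -
  define f where
    "f l = norm (string_prod U (take (Suc l) js) x - string_prod U (take l js) x)" for l
  obtain p where p: "p < length js" "js ! p = i"
    using i by (auto simp: in_set_conv_nth)
  define y where "y = string_prod U (take p js) x"
  have "norm (y - z) \<le> norm (x - z)"
    using string_prod_take_dist_le[of js U z p x, OF cut] p by (simp add: y_def)
  then have "y \<in> cball z r"
    using x by (simp add: dist_norm norm_minus_commute)
  then have last: "\<delta> * infdist y (Fix (U i)) \<le> f p"
    using reg[OF i] string_prod_take_Suc[OF p(1), of U x] p(2) by (simp add: f_def y_def)
  have first: "dist x y \<le> (\<Sum>k<p. f k)"
    using string_prod_take_displacement[of U p js x]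
    by (simp add: f_def y_def dist_norm norm_minus_commute)
  have "\<delta> * infdist x (Fix (U i)) \<le> \<delta> * infdist y (Fix (U i)) + \<delta> * dist x y"
    using infdist_triangle[of x "Fix (U i)" y] \<delta>
    by (simp add: distrib_left[symmetric])
  \<comment> \<open>On the way from \<open>x\<close> to \<open>y\<close> there are only step lengths, and the factor \<open>\<delta> \<le> 1\<close> is dropped.\<close>
  also have "\<delta> * dist x y \<le> dist x y"
    using \<delta> by (simp add: mult_left_le_one_le)
  finally have "\<delta> * infdist x (Fix (U i)) \<le> (\<Sum>k<Suc p. f k)"
    using first last by simp
  also have "\<dots> \<le> (\<Sum>k<length js. f k)"
    using p by (intro sum_mono2) (auto simp: f_def)
  finally have "(\<delta> * infdist x (Fix (U i)))\<^sup>2 \<le> (\<Sum>k<length js. f k)\<^sup>2"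
    using \<delta> infdist_nonneg[of x "Fix (U i)"] by (intro power_mono) auto
  also have "\<dots> \<le> length js * (\<Sum>k<length js. (f k)\<^sup>2)"
    using sum_squared_le_sum_of_squares[of f "{..<length js}"] by (simp add: mult.commute)
  finally show ?thesis
    by (simp add: power_mult_distrib f_def string_energy_def)
qed

section \<open>Averages of strings\<close>

text \<open>
  Jensen's inequality for the squared norm: the difference of the two sides is the weighted
  variance of the family \<open>a\<close> about its mean \<open>b\<close>.
\<close>
lemma norm_weighted_sum_power2_le:
  fixes a :: "'k \<Rightarrow> 'a::real_inner"
  assumes "\<And>n. n \<in> K \<Longrightarrow> 0 \<le> w n" and "sum w K = 1"
  shows "(norm (\<Sum>n\<in>K. w n *\<^sub>R a n))\<^sup>2 \<le> (\<Sum>n\<in>K. w n * (norm (a n))\<^sup>2)"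
proof -
  define b where "b = (\<Sum>n\<in>K. w n *\<^sub>R a n)"
  have "0 \<le> (\<Sum>n\<in>K. w n * (norm (a n - b))\<^sup>2)"
    using assms by (simp add: sum_nonneg)
  also have "\<dots> = (\<Sum>n\<in>K. w n * (norm (a n))\<^sup>2 - 2 * inner (w n *\<^sub>R a n) b + w n * (norm b)\<^sup>2)"
    by (intro sum.cong refl) (simp add: power2_norm_eq_inner inner_simps inner_commute algebra_simps)
  also have "\<dots> = (\<Sum>n\<in>K. w n * (norm (a n))\<^sup>2) - 2 * inner b b + (norm b)\<^sup>2"
    using assms(2)
    by (simp add: sum.distrib sum_subtractf b_def inner_sum_left flip: sum_distrib_left sum_distrib_right)
  finally show ?thesis
    by (simp add: b_def power2_norm_eq_inner)
qed

locale string_averaging =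
  fixes K :: "'k set" and w :: "'k \<Rightarrow> real" and J :: "'k \<Rightarrow> 'i list"
    and U :: "'i \<Rightarrow> 'a::real_inner \<Rightarrow> 'a" and C :: "'a set"
  assumes finite_K: "finite K"
    and weight_pos: "n \<in> K \<Longrightarrow> 0 < w n"
    and sum_weights: "sum w K = 1"
    and cutters: "n \<in> K \<Longrightarrow> i \<in> set (J n) \<Longrightarrow> cutter (U i)"
    and C_eq: "C = (\<Inter>n\<in>K. \<Inter>i\<in>set (J n). Fix (U i))"
    and C_nonempty: "C \<noteq> {}"
begin

definition average :: "'a \<Rightarrow> 'a" where
  "average x = (\<Sum>n\<in>K. w n *\<^sub>R string_prod U (J n) x)"

definition endpoint_energy :: "'a \<Rightarrow> real" where
  "endpoint_energy x = (\<Sum>n\<in>K. w n * (norm (string_prod U (J n) x - x))\<^sup>2)"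

definition step_energy :: "'a \<Rightarrow> real" where
  "step_energy x = (\<Sum>n\<in>K. w n * string_energy U (J n) x)"

lemma step_energy_nonneg: "0 \<le> step_energy x"
  unfolding step_energy_def
  by (intro sum_nonneg mult_nonneg_nonneg string_energy_nonneg) (simp add: weight_pos less_imp_le)

lemma average_displacement:
  "average x - x = (\<Sum>n\<in>K. w n *\<^sub>R (string_prod U (J n) x - x))"
  by (simp add: average_def scaleR_diff_right sum_subtractf sum_weights flip: scaleR_left.sum)

lemma average_displacement_le: "(norm (average x - x))\<^sup>2 \<le> endpoint_energy x"
  unfolding average_displacement endpoint_energy_def
  by (rule norm_weighted_sum_power2_le) (simp_all add: weight_pos less_imp_le sum_weights)

lemma average_inner_ge:
  assumes "z \<in> C"
  shows "endpoint_energy x + step_energy x \<le> 2 * inner (z - x) (average x - x)"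
proof -
  have "endpoint_energy x + step_energy x
        = (\<Sum>n\<in>K. w n * ((norm (string_prod U (J n) x - x))\<^sup>2 + string_energy U (J n) x))"
    by (simp add: endpoint_energy_def step_energy_def distrib_left sum.distrib)
  also have "\<dots> \<le> (\<Sum>n\<in>K. w n * (2 * inner (z - x) (string_prod U (J n) x - x)))"
    using assms cutters
    by (intro sum_mono mult_left_mono string_prod_inner_ge)
       (auto simp: C_eq weight_pos less_imp_le)
  also have "\<dots> = 2 * inner (z - x) (average x - x)"
    by (simp add: average_displacement inner_sum_right sum_distrib_left mult.left_commute)
  finally show ?thesis .
qed

lemma energies_on_C:
  assumes "x \<in> C"
  shows "average x = x" "endpoint_energy x = 0" "step_energy x = 0"
proof -
  have fixed: "string_prod U (J n) x = x" if "n \<in> K" for n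
    using assms that by (intro string_prod_fixed) (auto simp: C_eq Fix_def)
  then show avg: "average x = x"
    by (simp add: average_def sum_weights flip: scaleR_left.sum)
  show end0: "endpoint_energy x = 0"
    by (simp add: endpoint_energy_def fixed)
  show "step_energy x = 0"
    using average_inner_ge[OF assms, of x] step_energy_nonneg[of x] by (simp add: avg end0)
qed

text \<open>
  All weights are positive, so no string moves \<open>x\<close> at any of its steps.
\<close>
lemma step_energy_eq_0_imp:
  assumes "step_energy x = 0"
  shows "x \<in> C"
proof -
  have "string_energy U (J n) x = 0" if "n \<in> K" for n
  proof -
    have "0 \<le> w k * string_energy U (J k) x" if "k \<in> K" for k
      using weight_pos[OF that] string_energy_nonneg[of U "J k" x] by simp
    then have "w n * string_energy U (J n) x = 0"
      using assms that finite_K by (simp add: step_energy_def sum_nonneg_eq_0_iff)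
    then show ?thesis
      using weight_pos[OF that] by simp
  qed
  then show ?thesis
    by (auto simp: C_eq Fix_def intro: string_energy_eq_0_imp_fixed)
qed

text \<open>
  If the average does not move \<open>x\<close>, the right-hand side of \<open>average_inner_ge\<close> vanishes, and both
  energies with it.
\<close>
lemma average_fixed_iff: "average x = x \<longleftrightarrow> x \<in> C"
proof
  assume fixed: "average x = x"
  obtain z where "z \<in> C"
    using C_nonempty by blast
  moreover have "0 \<le> endpoint_energy x"
    using average_displacement_le[of x] by (simp add: fixed)
  ultimately have "step_energy x = 0"
    using average_inner_ge[of z x] step_energy_nonneg[of x] by (simp add: fixed)
  then show "x \<in> C"
    by (rule step_energy_eq_0_imp)
qed (rule energies_on_C)

lemma closed_C: "closed C"
  unfolding C_eq using cutters by (intro closed_INT ballI closed_Fix_cutter) auto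

lemma relaxed_step:
  assumes "z \<in> C" and "0 \<le> a"
  shows "a * (endpoint_energy x + step_energy x) - a\<^sup>2 * (norm (average x - x))\<^sup>2
           \<le> (norm (x - z))\<^sup>2 - (norm (x + a *\<^sub>R (average x - x) - z))\<^sup>2"
proof -
  define v where "v = average x - x"
  have "a * (endpoint_energy x + step_energy x) \<le> a * (2 * inner (z - x) v)"
    using average_inner_ge[OF assms(1)] assms(2) by (simp add: v_def mult_left_mono)
  moreover have "(norm (x - z))\<^sup>2 - (norm (x + a *\<^sub>R v - z))\<^sup>2
                 = a * (2 * inner (z - x) v) - a\<^sup>2 * (norm v)\<^sup>2"
    unfolding power2_norm_eq_inner
    by (simp add: inner_simps inner_commute power2_eq_square algebra_simps)
  ultimately show ?thesis
    by (simp add: v_def)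
qed

end

section \<open>Arithmetic of the extrapolation\<close>

text \<open>
  Throughout, \<open>q\<close> is the length of the longest string, \<open>s\<close> and \<open>t\<close> are the values of \<open>\<sigma>\<close> and \<open>\<tau>\<close>
  at a point, \<open>d\<close> is the squared displacement of the average there, and \<open>D\<close> and \<open>E\<close> are the end
  point and step energies, with sum \<open>G\<close>.
\<close>

lemma relaxation_pos:
  fixes q lam :: real
  assumes "1 \<le> q" "lam < 1 + 1 / q"
  shows "0 < 1 + q - q * lam"
proof -
  have "q * lam < q * (1 + 1 / q)"
    using assms by (intro mult_strict_left_mono) auto
  also have "\<dots> = q + 1"
    using assms by (simp add: field_simps)
  finally show ?thesis by simp
qed

lemma extrapolation_numerator_ge:
  fixes q lam s t :: real
  assumes "0 \<le> q" "0 \<le> lam" "1 \<le> s" "s \<le> t"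
  shows "1 + q - q * lam \<le> 1 + q - q * lam * (s / t)"
proof -
  have "s / t \<le> 1" using assms by simp
  then have "q * lam * (s / t) \<le> q * lam * 1"
    using assms by (intro mult_left_mono) auto
  then show ?thesis by simp
qed

lemma extrapolation_denominator_ge:
  fixes q t :: real
  assumes "0 \<le> q" "1 \<le> t"
  shows "1 \<le> 1 + q - q / t"
  using assms mult_left_mono[of 1 t q] by (simp add: field_simps)

text \<open>
  The ratio decreases when \<open>s / t\<close> in its numerator is raised to \<open>1\<close> and its denominator is enlarged
  to \<open>1 + q\<close>; the outer factor \<open>s\<close> is at least \<open>1\<close>.
\<close>
lemma extrapolation_factor_ge:
  fixes q lam s t :: real
  assumes "1 \<le> q" "0 < lam" "lam < 1 + 1 / q" "1 \<le> s" "s \<le> t"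
  shows "lam * (1 - lam * (q / (1 + q)))
           \<le> lam * s * ((1 + q - q * lam * (s / t)) / (1 + q - q / t))"
proof -
  have pos: "0 < 1 + q - q * lam"
    using relaxation_pos assms by simp
  have "1 - lam * (q / (1 + q)) = (1 + q - q * lam) / (1 + q)"
    using assms by (simp add: field_simps)
  also have "\<dots> \<le> (1 + q - q * lam * (s / t)) / (1 + q - q / t)"
    using extrapolation_numerator_ge[of q lam s t] extrapolation_denominator_ge[of q t] assms pos
    by (intro frac_le) auto
  finally have "1 * (1 - lam * (q / (1 + q)))
                \<le> s * ((1 + q - q * lam * (s / t)) / (1 + q - q / t))"
    using assms pos by (intro mult_mono) (auto simp: field_simps)
  then show ?thesis
    using mult_left_mono[of _ _ lam] assms by (simp only: mult_1_left mult.assoc less_imp_le)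
qed

text \<open>
  Write the factor as \<open>lam s P / R\<close>. The balance identity turns \<open>R (D + E)\<close> into \<open>(q + 1) (D + E - d)\<close>,
  which is at least \<open>(q + 1) E\<close> because \<open>d \<le> D\<close>; hence \<open>E / R\<close> can be traded for \<open>(D + E) / (q + 1)\<close>.
  The same identity shows that \<open>P (D + E) / (q + 1)\<close> is exactly \<open>D + E - lam s d\<close>.
\<close>
lemma extrapolation_factor_step:
  fixes q lam s t d D E :: real
  assumes "1 \<le> q" "0 < lam" "lam < 1 + 1 / q" "1 \<le> s" "s \<le> t" "d \<le> D"
    and balance: "t * d * (q + 1) = q * (D + E)"
  shows "lam * s * ((1 + q - q * lam * (s / t)) / (1 + q - q / t)) * E
           \<le> lam * s * (D + E) - (lam * s)\<^sup>2 * d"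
proof -
  define P where "P = 1 + q - q * lam * (s / t)"
  define R where "R = 1 + q - q / t"
  have P: "0 \<le> P"
    using relaxation_pos[of q lam] extrapolation_numerator_ge[of q lam s t] assms by (simp add: P_def)
  have R: "1 \<le> R"
    using extrapolation_denominator_ge assms by (simp add: R_def)
  have t: "q * (D + E) / t = (q + 1) * d"
    using assms by (simp add: field_simps)
  have "R * (D + E) = (q + 1) * (D + E) - q * (D + E) / t"
    by (simp add: R_def algebra_simps add_divide_distrib)
  then have "R * (D + E) = (q + 1) * (D + E - d)"
    unfolding t by (simp add: right_diff_distrib)
  then have "(q + 1) * E \<le> R * (D + E)"
    using assms by (simp add: mult_left_mono)
  then have "P * ((q + 1) * E) \<le> P * (R * (D + E))"
    using P by (rule mult_left_mono)
  then have "(q + 1) * (P / R * E) \<le> P * (D + E)"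
    using R by (simp add: field_simps)
  also have "P * (D + E) = (q + 1) * (D + E) - lam * s * (q * (D + E) / t)"
    by (simp add: P_def algebra_simps add_divide_distrib)
  also have "\<dots> = (q + 1) * (D + E - lam * s * d)"
    unfolding t by (simp add: algebra_simps)
  finally have "P / R * E \<le> D + E - lam * s * d"
    by (rule mult_left_le_imp_le) (use assms in simp)
  then have "lam * s * (P / R * E) \<le> lam * s * (D + E - lam * s * d)"
    using assms by (intro mult_left_mono) auto
  then show ?thesis
    by (simp add: P_def R_def algebra_simps power2_eq_square)
qed

text \<open>
  Replacing \<open>t\<close> by the smaller \<open>s\<close> in the balance identity gives \<open>s d (1 + 1/q) \<le> G\<close>. The constant
  \<open>1 / (lam q) + (1 - lam) / lam\<close> is what remains of \<open>1 + 1/q\<close> once the quadratic term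
  \<open>(lam s)\<^sup>2 d\<close> has been subtracted.
\<close>
lemma extrapolation_quasi_nonexpansive_step:
  fixes q lam s t d G :: real
  assumes "1 \<le> q" "0 < lam" "1 \<le> s" "s \<le> t" "0 \<le> d"
    and balance: "t * d * (q + 1) = q * G"
  shows "(1 / (lam * q) + (1 - lam) / lam) * ((lam * s)\<^sup>2 * d) \<le> lam * s * G - (lam * s)\<^sup>2 * d"
proof -
  have "s * d * (q + 1) \<le> t * d * (q + 1)"
    using assms by (intro mult_right_mono) auto
  then have "s * d * (1 + 1 / q) \<le> G"
    using assms balance by (simp add: field_simps)
  then have "lam * s * (s * d * (1 + 1 / q)) \<le> lam * s * G"
    using assms by (intro mult_left_mono) auto
  moreover have "(1 / (lam * q) + (1 - lam) / lam) * ((lam * s)\<^sup>2 * d)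
        = lam * s * (s * d * (1 + 1 / q)) - (lam * s)\<^sup>2 * d"
    using assms by (simp add: field_simps power2_eq_square)
  ultimately show ?thesis by simp
qed

text \<open>
  Completing the square, the maximum over \<open>lam\<close> is \<open>(1 + q)\<^sup>2 / (4 q)\<close>, and \<open>1 + q \<le> 2 q\<close>.
\<close>
lemma relaxation_factor_le:
  fixes q lam :: real
  assumes "1 \<le> q"
  shows "lam * (1 + q - q * lam) \<le> q"
proof -
  have "4 * q * (lam * (1 + q - q * lam)) = (1 + q)\<^sup>2 - (1 + q - 2 * q * lam)\<^sup>2"
    by (simp add: power2_eq_square algebra_simps)
  also have "\<dots> \<le> (1 + q)\<^sup>2"
    by simp
  also have "\<dots> \<le> (2 * q)\<^sup>2"
    using assms by (intro power_mono) auto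
  finally have "4 * q * (lam * (1 + q - q * lam)) \<le> 4 * q * q"
    by (simp add: power2_eq_square)
  then show ?thesis
    using assms by simp
qed

section \<open>From a Fejer gap to the distance\<close>

lemma infdist_power2_ge:
  assumes "C \<noteq> {}" "\<And>z. z \<in> C \<Longrightarrow> b \<le> (dist x z)\<^sup>2"
  shows "b \<le> (infdist x C)\<^sup>2"
proof -
  have "sqrt b \<le> infdist x C"
    unfolding infdist_notempty[OF assms(1)]
    using assms by (intro cINF_greatest real_le_lsqrt) auto
  then show ?thesis
    by (simp add: sqrt_le_D)
qed

text \<open>
  A point that comes closer to \<open>z\<close> by a certain gap must move: \<open>\<parallel>x - z\<parallel>\<^sup>2 - \<parallel>y - z\<parallel>\<^sup>2\<close> is at most
  \<open>2 \<parallel>y - x\<parallel> \<parallel>x - z\<parallel>\<close> by Cauchy--Schwarz. As this holds for every \<open>z\<close> in \<open>C\<close>, the infimum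
  turns \<open>\<parallel>x - z\<parallel>\<close> into the distance, one factor of which then cancels.
\<close>
lemma fejer_gap_displacement:
  fixes x y :: "'a::real_inner"
  assumes "C \<noteq> {}"
    and gap: "\<And>z. z \<in> C \<Longrightarrow> b * (infdist x C)\<^sup>2 \<le> (norm (x - z))\<^sup>2 - (norm (y - z))\<^sup>2"
  shows "b * infdist x C \<le> 2 * norm (y - x)"
proof (cases "infdist x C = 0")
  case False
  then have d: "0 < infdist x C"
    using infdist_nonneg[of x C] by linarith
  define e where "e = norm (y - x)"
  have each: "b * (infdist x C)\<^sup>2 \<le> 2 * e * dist x z" if "z \<in> C" for z
  proof -
    have "y - z = (x - z) + (y - x)"
      by simp
    then have "(norm (y - z))\<^sup>2 = (norm (x - z))\<^sup>2 + 2 * inner (x - z) (y - x) + e\<^sup>2"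
      by (simp add: e_def power2_norm_eq_inner inner_simps inner_commute)
    moreover have "- inner (x - z) (y - x) \<le> norm (x - z) * e"
      using Cauchy_Schwarz_ineq2[of "x - z" "y - x"] by (simp add: e_def)
    ultimately have "b * (infdist x C)\<^sup>2 \<le> 2 * (norm (x - z) * e)"
      using gap[OF that] zero_le_power2[of e] by linarith
    then show ?thesis
      by (simp add: dist_norm mult.commute mult.left_commute)
  qed
  have "b * (infdist x C)\<^sup>2 \<le> 2 * e * infdist x C"
  proof (cases "e = 0")
    case True
    then show ?thesis using each assms(1) by fastforce
  next
    case False
    then have e: "0 < e" by (simp add: e_def)
    have "b * (infdist x C)\<^sup>2 / (2 * e) \<le> infdist x C"
      unfolding infdist_notempty[OF assms(1)]
      using each e assms(1)
      by (intro cINF_greatest) (auto simp: field_simps infdist_notempty)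
    then show ?thesis
      using e by (simp add: field_simps)
  qed
  then show ?thesis
    using d by (simp add: e_def power2_eq_square)
qed simp

text \<open>
  The intersection is contained in every member of the family, so its distance to \<open>x\<close> dominates
  all of theirs. If it is positive, the regularity inequality can only hold with \<open>\<kappa> \<ge> 1\<close>; at a point
  of the intersection it says nothing about \<open>\<kappa>\<close>.
\<close>
lemma linearly_regular_family_constant_ge_1:
  assumes "linearly_regular_family \<kappa> S I D" "finite I" "I \<noteq> {}"
    and x: "x \<in> S" "0 < infdist x (\<Inter>i\<in>I. D i)"
  shows "1 \<le> \<kappa>"
proof -
  have "infdist x (D i) \<le> infdist x (\<Inter>i\<in>I. D i)" if "i \<in> I" for i
    using assms that by (intro infdist_mono) (auto simp: linearly_regular_family_def)
  then have "(MAX i\<in>I. infdist x (D i)) \<le> infdist x (\<Inter>i\<in>I. D i)"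
    using assms by (subst Max_le_iff) auto
  then have "\<kappa> * (MAX i\<in>I. infdist x (D i)) \<le> \<kappa> * infdist x (\<Inter>i\<in>I. D i)"
    using assms by (intro mult_left_mono) (auto simp: linearly_regular_family_def)
  moreover have "infdist x (\<Inter>i\<in>I. D i) \<le> \<kappa> * (MAX i\<in>I. infdist x (D i))"
    using assms by (auto simp: linearly_regular_family_def)
  ultimately have "1 * infdist x (\<Inter>i\<in>I. D i) \<le> \<kappa> * infdist x (\<Inter>i\<in>I. D i)"
    by linarith
  then show ?thesis
    using x(2) by (rule mult_right_le_imp_le)
qed

theorem theorem3p1:
  fixes M N m :: nat
    and I :: "nat set"
    and U :: "nat \<Rightarrow> 'a::{real_inner, complete_space} \<Rightarrow> 'a"
    and C :: "'a set"
    and J :: "nat \<Rightarrow> nat list"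
    and \<omega> :: "nat \<Rightarrow> real"
    and Q :: "nat \<Rightarrow> nat \<Rightarrow> 'a \<Rightarrow> 'a"
    and T Trel :: "'a \<Rightarrow> 'a"
    and lam \<rho> \<omega>min :: real
    and \<sigma> \<tau> \<Theta> :: "'a \<Rightarrow> real"
  assumes I_def: "I = {1..M}"
    and cutters: "\<And>i. i \<in> I \<Longrightarrow> cutter (U i)"
    and C_def: "C = (\<Inter>i\<in>I. Fix (U i))"
    and C_nonempty: "C \<noteq> {}"
    and strings: "\<And>n. n \<in> {1..N} \<Longrightarrow> index_string I (J n)"
    and cover: "I = (\<Union>n\<in>{1..N}. set (J n))"
    and weights: "\<And>n. n \<in> {1..N} \<Longrightarrow> 0 < \<omega> n \<and> \<omega> n \<le> 1"
    and weights_sum: "(\<Sum>n=1..N. \<omega> n) = 1"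
    and Q_def: "\<And>n l. Q n l = string_prod U (take l (J n))"
    and T_def: "\<And>x. T x = (\<Sum>n=1..N. \<omega> n *\<^sub>R string_prod U (J n) x)"
    and m_def: "m = (MAX n\<in>{1..N}. length (J n))"
    and lam: "0 < lam" "lam < 1 + 1 / real m"
    and \<tau>_def: "\<And>x. \<tau> x =
          (if x \<notin> C then
             (real m / (real m + 1) *
               (\<Sum>n=1..N. \<omega> n *
                  ((norm (string_prod U (J n) x - x))\<^sup>2 +
                   (\<Sum>l=1..length (J n). (norm (Q n l x - Q n (l - 1) x))\<^sup>2))))
             / (norm (T x - x))\<^sup>2
           else 1)"
    and \<sigma>: "\<And>x. 1 \<le> \<sigma> x \<and> \<sigma> x \<le> \<tau> x"
    and Trel_def: "\<And>x. Trel x = x + (lam * \<sigma> x) *\<^sub>R (T x - x)"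
    and \<rho>_def: "\<rho> = 1 / (lam * real m) + (1 - lam) / lam"
    and \<Theta>_def: "\<And>x. \<Theta> x =
          lam * \<sigma> x * ((1 + real m - real m * lam * (\<sigma> x / \<tau> x)) / (1 + real m - real m / \<tau> x))"
    and \<omega>min_def: "\<omega>min = (MIN n\<in>{1..N}. \<omega> n)"
  shows
    "(SQNE \<rho> Trel \<and> Fix Trel = C \<and> 0 < \<rho> \<and>
      (\<forall>x. \<forall>z\<in>C.
         \<Theta> x * (\<Sum>n=1..N. \<omega> n * (\<Sum>l=1..length (J n). (norm (Q n l x - Q n (l - 1) x))\<^sup>2))
           \<le> (norm (x - z))\<^sup>2 - (norm (Trel x - z))\<^sup>2) \<and>
      (\<forall>x. lam * (1 - lam * (real m / (1 + real m))) \<le> \<Theta> x) \<and>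
      0 < lam * (1 - lam * (real m / (1 + real m))))
     \<and>
     (\<forall>z\<in>C. \<forall>r>0. \<forall>\<delta>i \<delta>.
        (\<forall>i\<in>I. 0 < \<delta>i i \<and> \<delta>i i \<le> 1 \<and> linearly_regular_op (\<delta>i i) (cball z r) (U i)) \<and>
        \<delta> = (MIN i\<in>I. \<delta>i i) \<longrightarrow>
          (\<forall>x\<in>cball z r.
             \<delta>\<^sup>2 * (MAX i\<in>I. (infdist x (Fix (U i)))\<^sup>2)
               \<le> (\<Sum>n=1..N. \<Sum>l=1..length (J n).
                    real (length (J n)) * (norm (Q n l x - Q n (l - 1) x))\<^sup>2)))
     \<and>
     (\<forall>z\<in>C. \<forall>r>0. \<forall>\<delta>i \<delta> \<kappa>.
        (\<forall>i\<in>I. 0 < \<delta>i i \<and> \<delta>i i \<le> 1 \<and> linearly_regular_op (\<delta>i i) (cball z r) (U i)) \<and>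
        \<delta> = (MIN i\<in>I. \<delta>i i) \<and>
        linearly_regular_family \<kappa> (cball z r) I (\<lambda>i. Fix (U i)) \<longrightarrow>
          (\<forall>x\<in>cball z r.
             \<Theta> x * (\<omega>min * \<delta>\<^sup>2 / (2 * real m * \<kappa>\<^sup>2)) * infdist x C \<le> norm (Trel x - x)) \<and>
          ((cball z r \<subseteq> C \<longrightarrow> 1 \<le> \<kappa>) \<longrightarrow>
             (\<forall>x\<in>cball z r. \<Theta> x \<le> real m * \<kappa>\<^sup>2 / (\<omega>min * \<delta>\<^sup>2))))"
proof -
  \<comment> \<open>This keeps \<open>{1..N}\<close> from being rewritten to \<open>{Suc 0..N}\<close>, which would hide the parameters of the
     locale interpretation.\<close>
  note One_nat_def [simp del]
  have N: "{1..N} \<noteq> {}"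
    using weights_sum by (metis sum.empty zero_neq_one)
  have m_ge: "length (J n) \<le> m" if "n \<in> {1..N}" for n
    unfolding m_def using that by (intro Max_ge) auto
  have m: "1 \<le> real m"
  proof -
    obtain n where n: "n \<in> {1..N}"
      using N by blast
    then have "1 \<le> length (J n)"
      using strings[OF n] by (cases "J n") (auto simp: index_string_def)
    then show ?thesis
      using m_ge[OF n] by linarith
  qed
  have in_I: "i \<in> I" if "n \<in> {1..N}" "i \<in> set (J n)" for i n
    using strings[OF that(1)] that(2) by (auto simp: index_string_def)
  have finI: "finite I" and I_nonempty: "I \<noteq> {}"
  proof -
    show "finite I"
      by (simp add: I_def)
    obtain n where n: "n \<in> {1..N}"
      using N by blast
    then have "set (J n) \<noteq> {}"
      using strings[OF n] by (simp add: index_string_def)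
    then show "I \<noteq> {}"
      using in_I[OF n] by fastforce
  qed

  interpret A: string_averaging "{1..N}" \<omega> J U C
  proof
    show "C = (\<Inter>n\<in>{1..N}. \<Inter>i\<in>set (J n). Fix (U i))"
      by (simp only: C_def cover) auto
    show "cutter (U i)" if "n \<in> {1..N}" "i \<in> set (J n)" for n i
      using in_I[OF that] by (rule cutters)
  qed (use weights weights_sum C_nonempty in simp_all)

  have energy: "(\<Sum>l=1..length (J n). (norm (Q n l x - Q n (l - 1) x))\<^sup>2)
                = string_energy U (J n) x" for n x
    by (simp add: Q_def string_energy_def sum.atLeast1_atMost_eq One_nat_def)
  have step_energy: "(\<Sum>n=1..N. \<omega> n * (\<Sum>l=1..length (J n). (norm (Q n l x - Q n (l - 1) x))\<^sup>2))
                     = A.step_energy x" for x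
    by (simp only: energy A.step_energy_def)
  have T_eq: "T x = A.average x" for x
    by (simp only: T_def A.average_def)
  define d where "d x = (norm (T x - x))\<^sup>2" for x
  define D where "D = A.endpoint_energy"
  define E where "E = A.step_energy"

  have d_le: "d x \<le> D x" for x
    using A.average_displacement_le by (simp add: d_def D_def T_eq)
  have d_nonneg: "0 \<le> d x" for x
    by (simp add: d_def)

  \<comment> \<open>The identity that determines \<open>\<tau>\<close>. On \<open>C\<close> both sides are zero, so it holds for
     every \<open>x\<close>.\<close>
  have balance: "\<tau> x * d x * (real m + 1) = real m * (D x + E x)" for x
  proof (cases "x \<in> C")
    case True
    then show ?thesis
      by (simp add: d_def D_def E_def T_eq A.energies_on_C)
  next
    case False
    then have "d x \<noteq> 0"
      by (simp add: d_def T_eq A.average_fixed_iff)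
    moreover have "\<tau> x = (real m / (real m + 1) * (D x + E x)) / d x"
      using False
      by (simp add: \<tau>_def energy D_def E_def A.endpoint_energy_def A.step_energy_def d_def
          distrib_left sum.distrib)
    ultimately have "\<tau> x * d x = real m / (real m + 1) * (D x + E x)"
      by simp
    then show ?thesis
      using m by simp
  qed

  define a where "a x = lam * \<sigma> x" for x
  have a_pos: "0 < a x" for x
    using lam(1) \<sigma>[of x] by (simp add: a_def)
  have Trel_eq: "Trel x = x + a x *\<^sub>R (A.average x - x)" for x
    by (simp add: Trel_def T_eq a_def)
  have Trel_step: "(norm (Trel x - x))\<^sup>2 = (a x)\<^sup>2 * d x" for x
    by (simp add: Trel_def a_def d_def power_mult_distrib)
  have descent: "a x * (D x + E x) - (a x)\<^sup>2 * d x \<le> (norm (x - z))\<^sup>2 - (norm (Trel x - z))\<^sup>2"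
    if "z \<in> C" for x z
    using A.relaxed_step[OF that less_imp_le[OF a_pos], of x x]
    by (simp add: Trel_eq D_def E_def d_def T_eq)

  have fix_Trel: "Fix Trel = C"
    using a_pos[THEN less_imp_neq] by (auto simp: Fix_def Trel_eq A.average_fixed_iff)

  have \<rho>_pos: "0 < \<rho>"
  proof -
    have "\<rho> = (1 + real m - real m * lam) / (lam * real m)"
      using lam(1) m by (simp add: \<rho>_def field_simps)
    then show ?thesis
      using relaxation_pos[OF m lam(2)] lam(1) m by simp
  qed

  have sqne: "SQNE \<rho> Trel"
    unfolding SQNE_def fix_Trel
  proof (intro conjI allI ballI)
    fix x z assume "z \<in> C"
    have "\<rho> * (norm (Trel x - x))\<^sup>2 \<le> a x * (D x + E x) - (a x)\<^sup>2 * d x"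
      using extrapolation_quasi_nonexpansive_step[OF m lam(1) _ _ d_nonneg balance] \<sigma>
      by (simp add: \<rho>_def Trel_step a_def)
    with descent[OF \<open>z \<in> C\<close>, of x]
    show "(norm (Trel x - z))\<^sup>2 \<le> (norm (x - z))\<^sup>2 - \<rho> * (norm (Trel x - x))\<^sup>2"
      by linarith
  qed (use \<rho>_pos in simp)

  have \<Theta>_descent: "\<Theta> x * E x \<le> (norm (x - z))\<^sup>2 - (norm (Trel x - z))\<^sup>2" if "z \<in> C" for x z
  proof -
    have "\<Theta> x * E x \<le> a x * (D x + E x) - (a x)\<^sup>2 * d x"
      unfolding \<Theta>_def a_def
      using \<sigma> by (intro extrapolation_factor_step m lam d_le balance) auto
    then show ?thesis
      using descent[OF that, of x] by linarith
  qed

  have \<Theta>_ge: "lam * (1 - lam * (real m / (1 + real m))) \<le> \<Theta> x" for x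
    unfolding \<Theta>_def using \<sigma> by (intro extrapolation_factor_ge m lam) auto
  have \<Theta>_bound_pos: "0 < lam * (1 - lam * (real m / (1 + real m)))"
    using relaxation_pos[OF m lam(2)] lam(1) m by (intro mult_pos_pos) (simp_all add: field_simps)

  have Min_range: "0 < (MIN i\<in>I. c i) \<and> (MIN i\<in>I. c i) \<le> 1"
    if "\<And>i. i \<in> I \<Longrightarrow> 0 < c i \<and> c i \<le> (1::real)" for c
  proof -
    have "(MIN i\<in>I. c i) \<in> c ` I"
      using finI I_nonempty by (intro Min_in) auto
    then obtain i where "i \<in> I" "(MIN i\<in>I. c i) = c i"
      by blast
    then show ?thesis
      using that by simp
  qed

  have displacement: "\<delta>\<^sup>2 * (MAX i\<in>I. (infdist x (Fix (U i)))\<^sup>2)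
                      \<le> (\<Sum>n=1..N. real (length (J n)) * string_energy U (J n) x)"
    if z: "z \<in> C"
      and reg: "\<forall>i\<in>I. 0 < \<delta>i i \<and> \<delta>i i \<le> 1 \<and> linearly_regular_op (\<delta>i i) (cball z r) (U i)"
      and \<delta>: "\<delta> = (MIN i\<in>I. \<delta>i i)" and x: "x \<in> cball z r"
    for z r \<delta>i \<delta> x
  proof -
    have \<delta>_le: "\<delta> \<le> \<delta>i i" if "i \<in> I" for i
      unfolding \<delta> using that finI by (intro Min_le) auto
    have \<delta>_range: "0 < \<delta>" "\<delta> \<le> 1"
      using Min_range[of \<delta>i] reg by (simp_all add: \<delta>)
    have "(MAX i\<in>I. (infdist x (Fix (U i)))\<^sup>2) \<in> (\<lambda>i. (infdist x (Fix (U i)))\<^sup>2) ` I"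
      using finI I_nonempty by (intro Max_in) auto
    then obtain i where i: "i \<in> I" "(MAX i\<in>I. (infdist x (Fix (U i)))\<^sup>2) = (infdist x (Fix (U i)))\<^sup>2"
      by blast
    obtain n where n: "n \<in> {1..N}" "i \<in> set (J n)"
      using i(1) by (subst (asm) cover) blast
    have "\<delta>\<^sup>2 * (infdist x (Fix (U i)))\<^sup>2 \<le> real (length (J n)) * string_energy U (J n) x"
    proof (rule string_energy_regularity[OF _ \<delta>_range _ x n(2)])
      fix j assume "j \<in> set (J n)"
      with n(1) have j: "j \<in> I"
        by (rule in_I)
      then show "cutter (U j) \<and> z \<in> Fix (U j)"
        using cutters z by (simp add: C_def)
      fix y assume "y \<in> cball z r"
      then have "\<delta>i j * infdist y (Fix (U j)) \<le> norm (U j y - y)"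
        using reg j by (simp add: linearly_regular_op_def)
      moreover have "\<delta> * infdist y (Fix (U j)) \<le> \<delta>i j * infdist y (Fix (U j))"
        using \<delta>_le[OF j] infdist_nonneg by (rule mult_right_mono)
      ultimately show "\<delta> * infdist y (Fix (U j)) \<le> norm (U j y - y)"
        by linarith
    qed
    also have "\<dots> \<le> (\<Sum>n=1..N. real (length (J n)) * string_energy U (J n) x)"
      using n(1) by (intro member_le_sum) (auto simp: string_energy_nonneg)
    finally show ?thesis
      by (simp add: i(2))
  qed

  have \<omega>min_pos: "0 < \<omega>min"
    unfolding \<omega>min_def using N weights by (subst Min_gr_iff) auto
  have \<omega>min_le: "\<omega>min \<le> \<omega> n" if "n \<in> {1..N}" for n
    unfolding \<omega>min_def using that by (intro Min_le) auto
  have \<omega>min_le_1: "\<omega>min \<le> 1"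
    using N \<omega>min_le weights by (meson all_not_in_conv order_trans)

  \<comment> \<open>The sum in the regularity estimate is weighted by string lengths, \<open>E\<close> by the \<open>\<omega> n\<close>; comparing
     the two costs the factor \<open>m / \<omega>min\<close>.\<close>
  have strings_le: "\<omega>min * (\<Sum>n=1..N. real (length (J n)) * string_energy U (J n) x) \<le> real m * E x"
    for x
  proof -
    have "\<omega>min * (real (length (J n)) * string_energy U (J n) x)
          \<le> real m * (\<omega> n * string_energy U (J n) x)" if "n \<in> {1..N}" for n
    proof -
      have "\<omega>min * real (length (J n)) \<le> \<omega> n * real m"
        using \<omega>min_pos \<omega>min_le[OF that] m_ge[OF that] by (intro mult_mono) auto
      then have "\<omega>min * real (length (J n)) * string_energy U (J n) x
                 \<le> \<omega> n * real m * string_energy U (J n) x"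
        using string_energy_nonneg by (rule mult_right_mono)
      then show ?thesis
        by (simp add: mult_ac)
    qed
    then show ?thesis
      unfolding E_def A.step_energy_def sum_distrib_left by (rule sum_mono)
  qed

  have linear_bounds:
    "\<Theta> x * (\<omega>min * \<delta>\<^sup>2 / (2 * real m * \<kappa>\<^sup>2)) * infdist x C \<le> norm (Trel x - x) \<and>
     ((cball z r \<subseteq> C \<longrightarrow> 1 \<le> \<kappa>) \<longrightarrow> \<Theta> x \<le> real m * \<kappa>\<^sup>2 / (\<omega>min * \<delta>\<^sup>2))"
    if z: "z \<in> C"
      and reg: "\<forall>i\<in>I. 0 < \<delta>i i \<and> \<delta>i i \<le> 1 \<and> linearly_regular_op (\<delta>i i) (cball z r) (U i)"
      and \<delta>: "\<delta> = (MIN i\<in>I. \<delta>i i)"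
      and fam: "linearly_regular_family \<kappa> (cball z r) I (\<lambda>i. Fix (U i))"
      and x: "x \<in> cball z r"
    for z r \<delta>i \<delta> \<kappa> x
  proof -
    have \<kappa>_pos: "0 < \<kappa>"
      using fam by (simp add: linearly_regular_family_def)
    have \<delta>_pos: "0 < \<delta>" and \<delta>_le_1: "\<delta> \<le> 1"
      using Min_range[of \<delta>i] reg by (simp_all add: \<delta>)
    have \<Theta>_pos: "0 < \<Theta> x"
      using \<Theta>_ge[of x] \<Theta>_bound_pos by linarith
    define b where "b = \<omega>min * \<delta>\<^sup>2 / (real m * \<kappa>\<^sup>2)"
    have b_pos: "0 < b"
      using \<omega>min_pos \<delta>_pos m \<kappa>_pos by (simp add: b_def)

    have energy_ge: "b * (infdist x C)\<^sup>2 \<le> E x"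
    proof -
      have "(MAX i\<in>I. infdist x (Fix (U i))) \<in> (\<lambda>i. infdist x (Fix (U i))) ` I"
        using finI I_nonempty by (intro Max_in) auto
      then obtain j where j: "j \<in> I" "(MAX i\<in>I. infdist x (Fix (U i))) = infdist x (Fix (U j))"
        by blast
      have "infdist x C \<le> \<kappa> * infdist x (Fix (U j))"
        using fam x unfolding linearly_regular_family_def C_def j(2)[symmetric] by blast
      then have "(infdist x C)\<^sup>2 \<le> \<kappa>\<^sup>2 * (infdist x (Fix (U j)))\<^sup>2"
        using infdist_nonneg power_mono by (metis power_mult_distrib)
      then have "\<omega>min * \<delta>\<^sup>2 * (infdist x C)\<^sup>2 \<le> \<omega>min * \<delta>\<^sup>2 * (\<kappa>\<^sup>2 * (infdist x (Fix (U j)))\<^sup>2)"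
        using \<omega>min_pos by (intro mult_left_mono) auto
      also have "\<dots> = \<kappa>\<^sup>2 * (\<omega>min * (\<delta>\<^sup>2 * (infdist x (Fix (U j)))\<^sup>2))"
        by (simp add: mult_ac)
      also have "\<dots> \<le> \<kappa>\<^sup>2 * (\<omega>min * (\<delta>\<^sup>2 * (MAX i\<in>I. (infdist x (Fix (U i)))\<^sup>2)))"
        using j(1) finI \<omega>min_pos by (intro mult_left_mono Max_ge) auto
      also have "\<dots> \<le> \<kappa>\<^sup>2 * (\<omega>min * (\<Sum>n=1..N. real (length (J n)) * string_energy U (J n) x))"
        using displacement[OF z reg \<delta> x] \<omega>min_pos by (intro mult_left_mono) auto
      also have "\<dots> \<le> \<kappa>\<^sup>2 * (real m * E x)"
        using strings_le by (intro mult_left_mono) auto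
      finally show ?thesis
        using m \<kappa>_pos by (simp add: b_def field_simps)
    qed
    have gap: "\<Theta> x * b * (infdist x C)\<^sup>2 \<le> (norm (x - c))\<^sup>2 - (norm (Trel x - c))\<^sup>2"
      if "c \<in> C" for c
    proof -
      have "\<Theta> x * b * (infdist x C)\<^sup>2 \<le> \<Theta> x * E x"
        using mult_left_mono[OF energy_ge less_imp_le[OF \<Theta>_pos]] by (simp only: mult.assoc)
      then show ?thesis
        using \<Theta>_descent[OF that, of x] by linarith
    qed

    have "\<Theta> x * b * infdist x C \<le> 2 * norm (Trel x - x)"
      using C_nonempty gap by (rule fejer_gap_displacement)
    moreover have half_b: "\<omega>min * \<delta>\<^sup>2 / (2 * real m * \<kappa>\<^sup>2) = b / 2"
      by (simp add: b_def)
    ultimately have displacement_ge: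
      "\<Theta> x * (\<omega>min * \<delta>\<^sup>2 / (2 * real m * \<kappa>\<^sup>2)) * infdist x C \<le> norm (Trel x - x)"
      unfolding half_b by simp

    have "\<Theta> x \<le> 1 / b" if consistent: "cball z r \<subseteq> C \<longrightarrow> 1 \<le> \<kappa>"
    proof (cases "x \<in> C")
      case False
      then have "0 < infdist x C"
        using A.closed_C C_nonempty by (simp add: infdist_pos_not_in_closed)
      moreover have "\<Theta> x * b * (infdist x C)\<^sup>2 \<le> (infdist x C)\<^sup>2"
      proof (rule infdist_power2_ge[OF C_nonempty])
        fix c assume "c \<in> C"
        from gap[OF this] zero_le_power2[of "norm (Trel x - c)"]
        show "\<Theta> x * b * (infdist x C)\<^sup>2 \<le> (dist x c)\<^sup>2"
          unfolding dist_norm by linarith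
      qed
      ultimately have "\<Theta> x * b \<le> 1"
        by simp
      then show ?thesis
        using b_pos by (simp add: field_simps)
    next
      case True
      \<comment> \<open>At a point of \<open>C\<close> the descent estimate is void, and \<open>b \<le> 1 / m\<close> is needed instead. A point of
         the ball outside \<open>C\<close> forces \<open>1 \<le> \<kappa>\<close>; a ball inside \<open>C\<close> is the case covered by the
         assumption.\<close>
      have "1 \<le> \<kappa>"
      proof (cases "cball z r \<subseteq> C")
        case False
        then obtain y where "y \<in> cball z r" "y \<notin> C"
          by blast
        then show ?thesis
          using linearly_regular_family_constant_ge_1[OF fam finI I_nonempty, of y]
            infdist_pos_not_in_closed[OF A.closed_C C_nonempty, of y]
          by (simp add: C_def)
      qed (use consistent in simp)
      have "\<tau> x = 1" "\<sigma> x = 1"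
        using True \<sigma>[of x] by (auto simp: \<tau>_def)
      then have "\<Theta> x \<le> real m"
        using relaxation_factor_le[OF m, of lam] by (simp add: \<Theta>_def)
      moreover have "b \<le> 1 / real m"
      proof -
        have "\<delta>\<^sup>2 \<le> 1" "1 \<le> \<kappa>\<^sup>2"
          using \<delta>_pos \<delta>_le_1 \<open>1 \<le> \<kappa>\<close> by (simp_all add: power_le_one)
        then have "\<omega>min * \<delta>\<^sup>2 \<le> 1 * 1" "real m * 1 \<le> real m * \<kappa>\<^sup>2"
          using \<omega>min_pos \<omega>min_le_1 m by (intro mult_mono; simp)+
        then show ?thesis
          unfolding b_def using m by (intro frac_le) auto
      qed
      then have "real m \<le> 1 / b"
        using b_pos m by (simp add: field_simps)
      ultimately show ?thesis
        by linarith
    qed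
    then show ?thesis
      using displacement_ge by (simp add: b_def)
  qed

  show ?thesis
  proof (intro conjI)
    show "\<forall>x. \<forall>z\<in>C.
         \<Theta> x * (\<Sum>n=1..N. \<omega> n * (\<Sum>l=1..length (J n). (norm (Q n l x - Q n (l - 1) x))\<^sup>2))
           \<le> (norm (x - z))\<^sup>2 - (norm (Trel x - z))\<^sup>2"
      unfolding step_energy using \<Theta>_descent by (simp add: E_def)
  next
    show "\<forall>z\<in>C. \<forall>r>0. \<forall>\<delta>i \<delta>.
        (\<forall>i\<in>I. 0 < \<delta>i i \<and> \<delta>i i \<le> 1 \<and> linearly_regular_op (\<delta>i i) (cball z r) (U i)) \<and>
        \<delta> = (MIN i\<in>I. \<delta>i i) \<longrightarrow>
          (\<forall>x\<in>cball z r.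
             \<delta>\<^sup>2 * (MAX i\<in>I. (infdist x (Fix (U i)))\<^sup>2)
               \<le> (\<Sum>n=1..N. \<Sum>l=1..length (J n).
                    real (length (J n)) * (norm (Q n l x - Q n (l - 1) x))\<^sup>2))"
      unfolding sum_distrib_left[symmetric] energy using displacement by blast
  qed (use sqne fix_Trel \<rho>_pos \<Theta>_ge \<Theta>_bound_pos linear_bounds in blast)+
qed

end
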